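(* Let $0<|q|<1$. The $q$-difference equation $$w(z)\,w(z/q)=w(z)-z$$ has a formal power series solution $\widehat w(z)=\sum_{n=1}^\infty\widetilde c_n z^n$, which is given (as an identity of formal power series) by $$\widehat w(z)=z\,\frac{{}_2\phi_0(0,0;-;q,-z/q)}{{}_2\phi_0(0,0;-;q,-z)},$$ and its coefficients satisfy $$\widetilde c_n\sim\frac{q^{-\frac12n(n-1)}}{(q;q)_\infty},\qquad n\to\infty.$$
   Context: $(q;q)_n=(1-q)(1-q^2)\cdots(1-q^n)$, $(q;q)_0=1$, $(q;q)_\infty=\prod_{n=1}^\infty(1-q^n)$, and ${}_2\phi_0(0,0;-;q,x)$ denotes the formal power series $\sum_{n=0}^\infty\frac{q^{-\frac12n(n-1)}}{(q;q)_n}(-x)^n$. Here $\widetilde c_n\sim A_n$ means $\widetilde c_n/A_n\to1$. *)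

theory Defs
  imports "HOL-Analysis.Infinite_Products" "HOL-Computational_Algebra.Formal_Power_Series"
begin

definition qpoch :: "complex \<Rightarrow> nat \<Rightarrow> complex" where
  "qpoch q n = (\<Prod>k=1..n. 1 - q ^ k)"

definition qpoch_inf :: "complex \<Rightarrow> complex" where
  "qpoch_inf q = (\<Prod>n. 1 - q ^ Suc n)"

text \<open>The division in the exponent is exact, so \<open>1 / q ^ (n * (n - 1) div 2)\<close> is
  \<open>q\<close> to the power \<open>-n(n-1)/2\<close>.\<close>

definition phi20 :: "complex \<Rightarrow> complex fps" where
  "phi20 q = Abs_fps (\<lambda>n. (1 / q ^ (n * (n - 1) div 2)) / qpoch q n * (-1) ^ n)"

text \<open>The formal substitution \<open>f(z) \<mapsto> f(a z)\<close>.\<close>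

definition fps_dilate :: "complex \<Rightarrow> complex fps \<Rightarrow> complex fps" where
  "fps_dilate a f = f oo (fps_const a * fps_X)"

end

theory Submission
  imports Defs
begin

text \<open>
  Write \<open>t n = n (n - 1) / 2\<close> and \<open>A(z) = \<Sum>n. q\<^bsup>-t n\<^esup> z\<^sup>n / (q;q)\<^sub>n\<close>, which is
  \<open>phi20\<close> at \<open>-z\<close>. The series \<open>w(z) = z A(z/q) / A(z)\<close> linearises the equation:
  in \<open>w(z) w(z/q)\<close> the factor \<open>A(z/q)\<close> cancels, and what remains to be shown is
  \<open>A(z/q) - A(z) = (z/q) A(z/q\<^sup>2)\<close>. This holds coefficientwise because the
  factor \<open>q\<^bsup>-n\<^esup> - 1\<close> on the left removes the last factor of \<open>(q;q)\<^sub>n\<close>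
  (lemma \<open>qseries_dilate_diff\<close>).

  For the coefficients, \<open>R(z) = A(z/q) / A(z)\<close> satisfies \<open>R A = A(z/q)\<close>, and with the
  normalisation \<open>s\<^sub>n = q\<^bsup>t (n + 1)\<^esup> R\<^sub>n\<close> this becomes
  \[ s_n = \frac{1}{(q;q)_n} - \sum_{i<n} \frac{q^{(n-i)(i+1)}}{(q;q)_{n-i}} s_i . \]
  The exponents arise from \<open>t (a + b) = a b + t a + t b\<close>, and all of them are at least \<open>n\<close>.
  Hence the sum is at most a constant times \<open>\<bar>q\<bar>\<^sup>n\<close> times the sum of the
  earlier \<open>\<bar>s\<^sub>i\<bar>\<close>. So small a feedback cannot spoil boundedness, and
  for bounded \<open>s\<close> it tends to zero (lemma \<open>tendsto_geometric_feedback\<close>).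
  Therefore \<open>s\<^sub>n\<close> has the same limit as \<open>1/(q;q)\<^sub>n\<close>.
\<close>

section \<open>Sequences with geometrically small feedback\<close>

text \<open>Once \<open>M n r\<^sup>n \<le> 1/2\<close>, a bound \<open>B \<ge> 2 K\<close> for the earlier terms, \<open>K\<close> being a bound
  for \<open>u\<close>, is inherited by the next one, as \<open>K + B/2 \<le> B\<close>. So \<open>s\<close> is bounded by some \<open>B\<close>,
  and then its distance to \<open>u\<close> is at most \<open>M B n r\<^sup>n\<close>.\<close>

lemma tendsto_geometric_feedback:
  fixes s u :: "nat \<Rightarrow> 'a::real_normed_vector"
  assumes r: "0 \<le> r" "r < 1" and M: "0 \<le> M" and u: "u \<longlonglongrightarrow> L"
    and feedback: "\<And>n. norm (s n - u n) \<le> M * r ^ n * (\<Sum>i<n. norm (s i))"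
  shows "s \<longlonglongrightarrow> L"
proof -
  obtain K where K: "\<And>n. norm (u n) \<le> K"
    using convergent_imp_Bseq[OF convergentI[OF u]] by (auto simp: Bseq_def)
  have lim: "(\<lambda>n. M * (real n * r ^ n)) \<longlonglongrightarrow> 0"
    using tendsto_mult_right_zero[OF powser_times_n_limit_0[of r]] r by simp
  then have "\<forall>\<^sub>F n in sequentially. M * (real n * r ^ n) < 1/2"
    by (rule order_tendstoD) simp
  then obtain N where N: "\<And>n. n \<ge> N \<Longrightarrow> M * (real n * r ^ n) < 1/2"
    by (auto simp: eventually_sequentially)
  define B where "B = 2 * K + (\<Sum>i<N. norm (s i))"
  have "0 \<le> K" using K[of 0] norm_ge_zero order_trans by blast
  then have B: "2 * K \<le> B" "0 \<le> B" by (auto simp: B_def intro!: sum_nonneg add_nonneg_nonneg)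
  have feedbackB: "norm (s n - u n) \<le> M * (real n * r ^ n) * B"
    if "\<And>i. i < n \<Longrightarrow> norm (s i) \<le> B" for n
  proof -
    have "(\<Sum>i<n. norm (s i)) \<le> real n * B"
      using sum_bounded_above[of "{..<n}" "\<lambda>i. norm (s i)" B] that by simp
    then have "M * r ^ n * (\<Sum>i<n. norm (s i)) \<le> M * r ^ n * (real n * B)"
      using r M by (intro mult_left_mono) auto
    with feedback[of n] show ?thesis by (simp add: mult_ac)
  qed
  have bounded: "norm (s n) \<le> B" for n
  proof (induction n rule: less_induct)
    case (less n)
    show ?case
    proof (cases "n < N")
      case True
      then have "norm (s n) \<le> (\<Sum>i<N. norm (s i))"
        by (intro member_le_sum) auto
      with \<open>0 \<le> K\<close> show ?thesis by (simp add: B_def)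
    next
      case False
      then have "M * (real n * r ^ n) * B \<le> 1/2 * B"
        using N[of n] B by (intro mult_right_mono) auto
      moreover have "norm (s n - u n) \<le> M * (real n * r ^ n) * B"
        by (intro feedbackB less.IH)
      ultimately show ?thesis
        using K[of n] B(1) norm_triangle_sub[of "s n" "u n"] by linarith
    qed
  qed
  have "(\<lambda>n. s n - u n) \<longlonglongrightarrow> 0"
  proof (rule Lim_null_comparison)
    show "\<forall>\<^sub>F n in sequentially. norm (s n - u n) \<le> M * (real n * r ^ n) * B"
      by (intro always_eventually allI feedbackB bounded)
    show "(\<lambda>n. M * (real n * r ^ n) * B) \<longlonglongrightarrow> 0"
      using tendsto_mult_left_zero[OF lim] .
  qed
  from tendsto_add[OF this u] show ?thesis by simp
qed

section \<open>Triangular exponents and $q$-Pochhammer symbols\<close>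

definition tri :: "nat \<Rightarrow> nat" where
  "tri n = n * (n - 1) div 2"

lemma tri_Suc: "tri (Suc n) = tri n + n"
  by (cases n) (auto simp: tri_def)

lemma tri_add: "tri (a + b) = a * b + tri a + tri b"
proof (induction b)
  case 0
  show ?case by (simp add: tri_def)
next
  case (Suc b)
  then show ?case by (simp add: tri_Suc)
qed

lemma qpoch_0: "qpoch q 0 = 1"
  by (simp add: qpoch_def)

lemma qpoch_Suc: "qpoch q (Suc n) = qpoch q n * (1 - q ^ Suc n)"
  by (simp add: qpoch_def)

lemma one_minus_power_nonzero:
  fixes q :: complex
  assumes "norm q < 1"
  shows "1 - q ^ Suc n \<noteq> 0"
proof
  assume "1 - q ^ Suc n = 0"
  then have "q ^ Suc n = 1" by simp
  then have "norm q ^ Suc n = 1" by (metis norm_one norm_power)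
  moreover have "norm q ^ Suc n \<le> norm q"
    using assms by (intro power_Suc_le_self) auto
  ultimately show False using assms by simp
qed

lemma qpoch_nonzero: "norm q < 1 \<Longrightarrow> qpoch q n \<noteq> 0"
  by (induction n) (auto simp: qpoch_0 qpoch_Suc simp del: power_Suc
      dest: one_minus_power_nonzero)

lemma convergent_prod_qpoch:
  fixes q :: complex
  assumes "norm q < 1"
  shows "convergent_prod (\<lambda>n. 1 - q ^ Suc n)"
proof -
  have "summable (\<lambda>n. norm q ^ Suc n)"
    using assms by (subst summable_Suc_iff) (simp add: summable_geometric)
  then have "summable (\<lambda>n. norm ((1 - q ^ Suc n) - 1))"
    by (simp add: norm_mult norm_power)
  then show ?thesis
    using abs_convergent_prod_conv_summable abs_convergent_prod_imp_convergent_prod by blast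
qed

lemma qpoch_inf_nonzero: "norm q < 1 \<Longrightarrow> qpoch_inf q \<noteq> 0"
  unfolding qpoch_inf_def
  by (rule prodinf_nonzero[OF convergent_prod_qpoch]) (auto dest: one_minus_power_nonzero
      simp del: power_Suc)

lemma qpoch_tendsto:
  assumes "norm q < 1"
  shows "qpoch q \<longlonglongrightarrow> qpoch_inf q"
proof -
  have "(\<Prod>i\<le>n. 1 - q ^ Suc i) = qpoch q (Suc n)" for n
    by (induction n) (auto simp: qpoch_0 qpoch_Suc simp del: power_Suc)
  then have "(\<lambda>n. qpoch q (Suc n)) \<longlonglongrightarrow> qpoch_inf q"
    using convergent_prod_LIMSEQ[OF convergent_prod_qpoch[OF assms]]
    by (simp add: qpoch_inf_def del: power_Suc)
  then show ?thesis by (rule LIMSEQ_imp_Suc)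
qed

section \<open>Dilation of formal power series\<close>

lemma fps_dilate_nth: "fps_nth (fps_dilate a f) n = a ^ n * fps_nth f n"
  by (simp add: fps_dilate_def fps_compose_linear)

lemma fps_dilate_mult: "fps_dilate a (f * g) = fps_dilate a f * fps_dilate a g"
  by (simp add: fps_dilate_def fps_compose_mult_distrib)

lemma fps_dilate_X: "fps_dilate a fps_X = fps_const a * fps_X"
  by (simp add: fps_dilate_def)

lemma fps_dilate_dilate: "fps_dilate a (fps_dilate b f) = fps_dilate (a * b) f"
  by (rule fps_ext) (simp add: fps_dilate_nth power_mult_distrib mult_ac)

section \<open>The linearised equation\<close>

text \<open>With this sign of the argument the coefficients lose the factor \<open>(-1)\<^sup>n\<close>.\<close>

definition qseries :: "complex \<Rightarrow> complex fps" where
  "qseries q = fps_dilate (-1) (phi20 q)"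

lemma qseries_nth: "fps_nth (qseries q) n = 1 / (q ^ tri n * qpoch q n)"
  by (simp add: qseries_def fps_dilate_nth phi20_def tri_def flip: power_mult_distrib)

lemma qseries_nth_0: "fps_nth (qseries q) 0 = 1"
  by (simp add: qseries_nth tri_def qpoch_0)

lemma dilate_phi20: "fps_dilate (- 1 / q) (phi20 q) = fps_dilate (1 / q) (qseries q)"
  by (simp add: qseries_def fps_dilate_dilate)

lemma qseries_dilate_diff:
  assumes "q \<noteq> 0" "norm q < 1"
  shows "fps_dilate (1 / q) (qseries q) - qseries q
       = fps_const (1 / q) * fps_X * fps_dilate (1 / q) (fps_dilate (1 / q) (qseries q))"
proof (rule fps_ext)
  fix n
  show "fps_nth (fps_dilate (1 / q) (qseries q) - qseries q) n
      = fps_nth (fps_const (1 / q) * fps_X *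
          fps_dilate (1 / q) (fps_dilate (1 / q) (qseries q))) n"
  proof (cases n)
    case 0
    then show ?thesis by (simp add: fps_dilate_nth mult.assoc)
  next
    case (Suc m)
    have nz: "qpoch q m \<noteq> 0" "1 - q ^ Suc m \<noteq> 0"
      using assms qpoch_nonzero one_minus_power_nonzero by auto
    have "1 / (q ^ Suc m * (q ^ (tri m + m) * (qpoch q m * (1 - q ^ Suc m))))
            - 1 / (q ^ (tri m + m) * (qpoch q m * (1 - q ^ Suc m)))
        = (1 - q ^ Suc m) / (q ^ Suc m * (q ^ (tri m + m) * (qpoch q m * (1 - q ^ Suc m))))"
      using assms(1) by (simp only: diff_divide_distrib) simp
    also have "\<dots> = 1 / (q ^ Suc m * (q ^ (tri m + m) * qpoch q m))"
      using nz by (simp del: power_Suc)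
    also have "\<dots> = 1 / q * ((1 / q) ^ m * ((1 / q) ^ m * (1 / (q ^ tri m * qpoch q m))))"
      by (simp add: power_add power_divide mult_ac)
    finally show ?thesis
      by (simp add: Suc fps_dilate_nth qseries_nth tri_Suc qpoch_Suc mult.assoc power_divide
          del: power_Suc)
  qed
qed

section \<open>The coefficients of the quotient\<close>

definition qratio :: "complex \<Rightarrow> complex fps" where
  "qratio q = fps_dilate (1 / q) (qseries q) / qseries q"

lemma qratio_mult: "qratio q * qseries q = fps_dilate (1 / q) (qseries q)"
  by (simp add: qratio_def fps_divide_unit qseries_nth_0 mult.assoc inverse_mult_eq_1)

lemma qratio_solves:
  assumes "q \<noteq> 0" "norm q < 1"
  shows "(fps_X * qratio q) * fps_dilate (1 / q) (fps_X * qratio q)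
       = fps_X * qratio q - fps_X"
proof -
  let ?A = "qseries q" and ?R = "qratio q" and ?D = "fps_dilate (1 / q)"
  have "?R * ?D ?R * ?A = ?D ?R * ?D ?A"
    by (metis qratio_mult mult.assoc mult.commute)
  also have "\<dots> = ?D (?D ?A)"
    by (metis fps_dilate_mult qratio_mult)
  finally have "(fps_const (1 / q) * fps_X * (?R * ?D ?R)) * ?A = (?R - 1) * ?A"
    using qseries_dilate_diff[OF assms] by (simp add: qratio_mult left_diff_distrib mult.assoc)
  moreover have "?A \<noteq> 0" using qseries_nth_0[of q] by auto
  ultimately have "fps_const (1 / q) * fps_X * (?R * ?D ?R) = ?R - 1" by simp
  then have "fps_X * (fps_const (1 / q) * fps_X * (?R * ?D ?R)) = fps_X * ?R - fps_X"
    by (simp add: right_diff_distrib)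
  then show ?thesis by (simp add: fps_dilate_mult fps_dilate_X mult_ac)
qed

text \<open>Multiplying the convolution identity for \<open>qratio q * qseries q\<close> by
  \<open>q ^ tri (Suc n)\<close> and applying \<open>tri_add\<close> to \<open>Suc n = (n - i) + Suc i\<close> turns all the negative
  powers of \<open>q\<close> into the positive ones \<open>q ^ ((n - i) * Suc i)\<close>.\<close>

lemma qratio_normalized_recurrence:
  assumes "q \<noteq> 0"
  defines "s \<equiv> \<lambda>n. q ^ tri (Suc n) * fps_nth (qratio q) n"
  shows "s n = 1 / qpoch q n - (\<Sum>i<n. q ^ ((n - i) * Suc i) / qpoch q (n - i) * s i)"
proof -
  let ?R = "fps_nth (qratio q)" and ?A = "fps_nth (qseries q)"
  have "(\<Sum>i\<le>n. ?R i * ?A (n - i)) = (1 / q) ^ n * ?A n"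
    using arg_cong[OF qratio_mult[of q], of "\<lambda>f. fps_nth f n"]
    by (simp add: fps_mult_nth fps_dilate_nth atLeast0AtMost)
  then have "?R n + (\<Sum>i<n. ?R i * ?A (n - i)) = (1 / q) ^ n * ?A n"
    by (simp add: qseries_nth_0 add.commute flip: lessThan_Suc_atMost)
  then have "s n + q ^ tri (Suc n) * (\<Sum>i<n. ?R i * ?A (n - i))
           = q ^ tri (Suc n) * ((1 / q) ^ n * ?A n)"
    unfolding s_def by (metis distrib_left)
  moreover have "q ^ tri (Suc n) * ((1 / q) ^ n * ?A n) = 1 / qpoch q n"
    using assms(1) by (simp add: qseries_nth tri_Suc power_add power_divide)
  moreover have "q ^ tri (Suc n) * (\<Sum>i<n. ?R i * ?A (n - i))
      = (\<Sum>i<n. q ^ ((n - i) * Suc i) / qpoch q (n - i) * s i)"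
  proof (unfold sum_distrib_left, rule sum.cong)
    fix i assume "i \<in> {..<n}"
    then have "Suc n = (n - i) + Suc i" by simp
    then have "tri (Suc n) = (n - i) * Suc i + tri (n - i) + tri (Suc i)"
      by (metis tri_add)
    then show "q ^ tri (Suc n) * (?R i * ?A (n - i))
             = q ^ ((n - i) * Suc i) / qpoch q (n - i) * s i"
      using assms(1) by (simp only: power_add qseries_nth s_def) simp
  qed simp
  ultimately show ?thesis by (simp add: algebra_simps)
qed

lemma qratio_normalized_tendsto:
  assumes "q \<noteq> 0" "norm q < 1"
  shows "(\<lambda>n. q ^ tri (Suc n) * fps_nth (qratio q) n) \<longlonglongrightarrow> 1 / qpoch_inf q"
proof -
  define s where "s n = q ^ tri (Suc n) * fps_nth (qratio q) n" for n
  have lim: "(\<lambda>n. 1 / qpoch q n) \<longlonglongrightarrow> 1 / qpoch_inf q"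
    by (intro tendsto_intros qpoch_tendsto qpoch_inf_nonzero assms)
  then obtain M where M: "\<And>n. norm (1 / qpoch q n) \<le> M"
    using convergent_imp_Bseq[OF convergentI] by (metis Bseq_def)
  have "0 \<le> M" using M[of 0] norm_ge_zero order_trans by blast
  have "norm (s n - 1 / qpoch q n) \<le> M * norm q ^ n * (\<Sum>i<n. norm (s i))" for n
  proof -
    have "norm (s n - 1 / qpoch q n)
        = norm (\<Sum>i<n. q ^ ((n - i) * Suc i) / qpoch q (n - i) * s i)"
      using qratio_normalized_recurrence[OF assms(1), of n] by (simp add: s_def)
    also have "\<dots> \<le> (\<Sum>i<n. M * norm q ^ n * norm (s i))"
    proof (rule sum_norm_le)
      fix i assume "i \<in> {..<n}"
      then obtain k where k: "n = Suc (i + k)" by (auto dest: less_imp_Suc_add)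
      then have "n \<le> (n - i) * Suc i" by simp
      then have "norm q ^ ((n - i) * Suc i) \<le> norm q ^ n"
        using assms(2) by (intro power_decreasing) auto
      then have "norm q ^ ((n - i) * Suc i) * norm (1 / qpoch q (n - i)) * norm (s i)
          \<le> norm q ^ n * M * norm (s i)"
        by (intro mult_right_mono mult_mono M) auto
      then show "norm (q ^ ((n - i) * Suc i) / qpoch q (n - i) * s i)
          \<le> M * norm q ^ n * norm (s i)"
        by (simp add: norm_mult norm_divide norm_power mult_ac del: mult_Suc_right)
    qed
    finally show ?thesis by (simp add: sum_distrib_left)
  qed
  then have "s \<longlonglongrightarrow> 1 / qpoch_inf q"
    by (rule tendsto_geometric_feedback[OF norm_ge_zero assms(2) \<open>0 \<le> M\<close> lim])
  then show ?thesis by (simp add: s_def[abs_def])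
qed

section \<open>The formal solution and its asymptotics\<close>

theorem mainTheorem4:
  fixes q :: complex
  assumes "0 < norm q" and "norm q < 1"
  shows "\<exists>w :: complex fps.
           fps_nth w 0 = 0
         \<and> w * fps_dilate (1 / q) w = w - fps_X
         \<and> w = fps_X * (fps_dilate (- 1 / q) (phi20 q) / fps_dilate (- 1) (phi20 q))
         \<and> (\<lambda>n. fps_nth w n / ((1 / q ^ (n * (n - 1) div 2)) / qpoch_inf q)) \<longlonglongrightarrow> 1"
proof (intro exI conjI)
  let ?w = "fps_X * qratio q"
  have q: "q \<noteq> 0" "norm q < 1" using assms by auto
  show "fps_nth ?w 0 = 0" by simp
  show "?w * fps_dilate (1 / q) ?w = ?w - fps_X" by (rule qratio_solves[OF q])
  show "?w = fps_X * (fps_dilate (- 1 / q) (phi20 q) / fps_dilate (- 1) (phi20 q))"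
    by (simp only: qratio_def dilate_phi20 qseries_def)
  have "(\<lambda>n. q ^ tri (Suc n) * fps_nth (qratio q) n * qpoch_inf q) \<longlonglongrightarrow> 1"
    using tendsto_mult_right[OF qratio_normalized_tendsto[OF q], of "qpoch_inf q"]
      qpoch_inf_nonzero[OF q(2)] by simp
  then have "(\<lambda>n. fps_nth ?w (Suc n) / ((1 / q ^ tri (Suc n)) / qpoch_inf q)) \<longlonglongrightarrow> 1"
    by (simp add: mult_ac)
  then show "(\<lambda>n. fps_nth ?w n / ((1 / q ^ (n * (n - 1) div 2)) / qpoch_inf q)) \<longlonglongrightarrow> 1"
    unfolding tri_def by (rule LIMSEQ_imp_Suc)
qed

end
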